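(* Let $G$ be a connected graph with $\chi(G)=k\ge 3$. Let $\mathscr C_0=\{V_1,V_2,\dots,V_r\}$ be a Sudoku coloring of $G$ defined on an induced subgraph $G[S]$ for some $S\subset V(G)$, where $V_1,\dots,V_r$ are the (nonempty) color classes of $\mathscr C_0$. Then $r=k-1$ or $r=k$.
   Context: Graphs are finite, undirected and simple. Let $G=(V,E)$ be a connected graph with chromatic number $\chi(G)=k\ge 2$. For $S\subset V$, a partial coloring on $G[S]$ is a proper coloring $\mathscr C_0$ of the induced subgraph $G[S]$ with colors from $\{1,\dots,k\}$ (not all colors need be used); it may be written as the collection of its color classes. It is a Sudoku coloring of $G$ if there is exactly one proper $k$-coloring $V\to\{1,\dots,k\}$ of $G$ whose restriction to $S$ is $\mathscr C_0$. *)

theory Defs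
  imports "Graph_Theory.Digraph_Component" "HOL-Library.FuncSet"
begin

text \<open>
  A finite simple undirected graph is an instance of the locale \<^locale>\<open>graph\<close>: a finite
  symmetric digraph without loops and parallel arcs.

  Colorings are extensional functions (equal to \<^term>\<open>undefined\<close> off the vertex set), so that
  two colorings of a graph are equal exactly when they agree on all its vertices.
\<close>

definition proper_coloring :: "('a, 'b) pre_digraph \<Rightarrow> nat \<Rightarrow> ('a \<Rightarrow> nat) \<Rightarrow> bool" where
  "proper_coloring G k c \<longleftrightarrow>
     c \<in> verts G \<rightarrow>\<^sub>E {1..k} \<and> (\<forall>u v. u \<rightarrow>\<^bsub>G\<^esub> v \<longrightarrow> c u \<noteq> c v)"

definition chromatic_number :: "('a, 'b) pre_digraph \<Rightarrow> nat" where
  "chromatic_number G = (LEAST k. \<exists>c. proper_coloring G k c)"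

definition partial_coloring ::
    "('a, 'b) pre_digraph \<Rightarrow> 'a set \<Rightarrow> ('a \<Rightarrow> nat) \<Rightarrow> bool" where
  "partial_coloring G S c\<^sub>0 \<longleftrightarrow>
     S \<subseteq> verts G \<and> proper_coloring (G \<restriction> S) (chromatic_number G) c\<^sub>0"

definition sudoku_coloring ::
    "('a, 'b) pre_digraph \<Rightarrow> 'a set \<Rightarrow> ('a \<Rightarrow> nat) \<Rightarrow> bool" where
  "sudoku_coloring G S c\<^sub>0 \<longleftrightarrow>
     partial_coloring G S c\<^sub>0 \<and>
     (\<exists>!c. proper_coloring G (chromatic_number G) c \<and> restrict c S = c\<^sub>0)"

definition color_classes :: "'a set \<Rightarrow> ('a \<Rightarrow> nat) \<Rightarrow> 'a set set" where
  "color_classes S c = {{v \<in> S. c v = i} |i. i \<in> c ` S}"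

end

theory Submission
  imports Defs "HOL-Combinatorics.Transposition"
begin

text \<open>
  If two colors are missing on \<open>S\<close>, exchanging them in the unique extension does not change it on
  \<open>S\<close>, so by uniqueness the extension uses neither of them. It is then a coloring with fewer than
  \<open>\<chi>(G)\<close> colors, which is impossible.
\<close>

text \<open>Classes of used colors are nonempty, so different colors have different classes. This
  lets \<open>r\<close> be read as the number of colors used on \<open>S\<close>.\<close>

lemma card_color_classes: "card (color_classes S c) = card (c ` S)"
proof -
  have "color_classes S c = (\<lambda>i. {v \<in> S. c v = i}) ` c ` S"
    by (auto simp: color_classes_def)
  moreover have "inj_on (\<lambda>i. {v \<in> S. c v = i}) (c ` S)"
    by (rule inj_onI) auto
  ultimately show ?thesis
    by (simp add: card_image)
qed

text \<open>Renaming colors by a bijection preserves properness. The \<open>restrict\<close> keeps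
  the result extensional: \<open>undefined\<close> is some natural number, which
  \<open>transpose i j\<close> might move.\<close>

lemma (in wf_digraph) proper_coloring_transpose:
  assumes "proper_coloring G k c" "i \<in> {1..k}" "j \<in> {1..k}"
  shows "proper_coloring G k (restrict (transpose i j \<circ> c) (verts G))"
proof -
  have "transpose i j (c v) \<in> {1..k}" if "v \<in> verts G" for v
    using assms that by (auto simp: proper_coloring_def transpose_def PiE_iff)
  moreover have "transpose i j (c u) \<noteq> transpose i j (c v)" if "u \<rightarrow>\<^bsub>G\<^esub> v" for u v
    using assms(1) that unfolding proper_coloring_def by (metis transpose_involutory)
  ultimately show ?thesis
    using adj_in_verts unfolding proper_coloring_def by simp
qed

lemma (in wf_digraph) optimal_coloring_surj:
  assumes c: "proper_coloring G (chromatic_number G) c" and i: "i \<in> {1..chromatic_number G}"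
  shows "i \<in> c ` verts G"
proof (rule ccontr)
  assume notin: "i \<notin> c ` verts G"
  define k where "k = chromatic_number G"
  define d where "d = restrict (transpose i k \<circ> c) (verts G)"
  have d: "proper_coloring G k d"
    unfolding d_def k_def using c i by (intro proper_coloring_transpose) auto
  have "d v \<in> {1..k - 1}" if "v \<in> verts G" for v
  proof -
    have "d v \<noteq> k"
      using notin that by (auto simp: d_def transpose_def)
    moreover have "d v \<in> {1..k}"
      using d that by (auto simp: proper_coloring_def)
    ultimately show ?thesis
      by auto
  qed
  then have "proper_coloring G (k - 1) d"
    using d by (auto simp: proper_coloring_def PiE_iff)
  then have "k \<le> k - 1"
    unfolding k_def chromatic_number_def by (intro Least_le exI)
  \<comment> \<open>Subtraction is truncated, so \<open>k \<le> k - 1\<close> is absurd only for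
    positive \<open>k\<close>; the range of \<open>i\<close> ensures that.\<close>
  with i show False
    unfolding k_def atLeastAtMost_iff by linarith
qed

lemma (in wf_digraph) sudoku_coloring_missing_color_unique:
  assumes sudoku: "sudoku_coloring G S c\<^sub>0"
    and i: "i \<in> {1..chromatic_number G} - c\<^sub>0 ` S"
    and j: "j \<in> {1..chromatic_number G} - c\<^sub>0 ` S"
  shows "i = j"
proof -
  have S: "S \<subseteq> verts G"
    using sudoku by (auto simp: sudoku_coloring_def partial_coloring_def)
  obtain c where c: "proper_coloring G (chromatic_number G) c" "restrict c S = c\<^sub>0"
    and uniq: "\<And>d. proper_coloring G (chromatic_number G) d \<Longrightarrow> restrict d S = c\<^sub>0 \<Longrightarrow> d = c"
    using sudoku unfolding sudoku_coloring_def by metis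
  define d where "d = restrict (transpose i j \<circ> c) (verts G)"
  have "proper_coloring G (chromatic_number G) d"
    unfolding d_def using c i j by (intro proper_coloring_transpose) auto
  moreover have "restrict d S = c\<^sub>0"
  proof -
    \<comment> \<open>On \<open>S\<close> the extension \<open>c\<close> agrees with
      \<open>c\<^sub>0\<close>, which avoids both colors, so the exchange fixes every color
      there.\<close>
    have "c v \<noteq> i \<and> c v \<noteq> j" if "v \<in> S" for v
      using i j that c(2) by auto
    then have "restrict d S = restrict c S"
      using S by (intro restrict_ext) (auto simp: d_def transpose_def)
    with c(2) show ?thesis by simp
  qed
  ultimately have "d = c"
    by (rule uniq)
  \<comment> \<open>Although \<open>i\<close> is missing on \<open>S\<close>, the optimal coloring
    \<open>c\<close> uses it somewhere; comparing \<open>d\<close> and \<open>c\<close> at such a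
    vertex gives \<open>i = j\<close>.\<close>
  obtain v where "v \<in> verts G" "c v = i"
    using optimal_coloring_surj[OF c(1)] i by blast
  moreover from this have "d v = j"
    by (simp add: d_def)
  ultimately show ?thesis
    using \<open>d = c\<close> by simp
qed

theorem mainTheorem13:
  fixes G :: "('a, 'b) pre_digraph" and k r :: nat
    and S :: "'a set" and c\<^sub>0 :: "'a \<Rightarrow> nat"
  assumes "graph G"
    and "connected G"
    and "chromatic_number G = k" and "k \<ge> 3"
    and "sudoku_coloring G S c\<^sub>0"
    and "r = card (color_classes S c\<^sub>0)"
  shows "r = k - 1 \<or> r = k"
proof -
  interpret graph G by fact
  have sub: "c\<^sub>0 ` S \<subseteq> {1..k}"
    using assms(3,5)
    by (auto simp: sudoku_coloring_def partial_coloring_def proper_coloring_def)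
  have "card ({1..k} - c\<^sub>0 ` S) \<le> 1"
    using sudoku_coloring_missing_color_unique[OF assms(5)] assms(3)
    by (auto simp: card_le_Suc0_iff_eq)
  moreover have "card ({1..k} - c\<^sub>0 ` S) = k - r"
    using sub by (simp add: assms(6) card_color_classes card_Diff_subset finite_subset)
  \<comment> \<open>The bound \<open>k - r \<le> 1\<close> on naturals would also hold for every
    \<open>r\<close> above \<open>k\<close>.\<close>
  moreover have "r \<le> k"
    using card_mono[OF _ sub] by (simp add: assms(6) card_color_classes)
  ultimately show ?thesis
    by linarith
qed

end
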